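(* An immersed curve $X:\mathbb{R}\to\mathbb{R}^2$ is an affine self-similar solution of the affine curve shortening flow if and only if it satisfies $$\langle BX+C,N\rangle=k^{1/3}$$ for some $B\in\mathbb{R}^{2\times 2}$ and $C\in\mathbb{R}^2$, where $N$ and $k$ are the unit normal and the curvature of $X$. Moreover, the family $(A(t),H(t))$ of self-similar actions on a curve $X$ satisfying this equation is given by $$A(t)=\begin{cases}\exp(tB)&\text{if }\operatorname{tr}B=0,\\ \exp\left(\dfrac{3}{2\operatorname{tr}B}\ln\left(1+\tfrac23\operatorname{tr}B\cdot t\right)B\right)&\text{if }\operatorname{tr}B\neq 0,\end{cases}$$ and $$H(t)=\left(\int_0^t(\det A(s))^{-2/3}A(s)\,ds\right)C.$$
   Context: For an immersed curve $X=X(u)$ in $\mathbb{R}^2$, put $T=X_u/\|X_u\|$, $N=JT$ with $J=\begin{pmatrix}0&-1\\1&0\end{pmatrix}$ (unit normal), and $k=\det(X_u,X_{uu})/\|X_u\|^3$ (curvature with respect to $N$). $\langle\cdot,\cdot\rangle$ is the Euclidean inner product and $k^{1/3}$ is the real (odd) cube root. Curves are smooth. The affine curve shortening flow (ACSF) is the evolution equation $\hat X_t=\hat k^{1/3}\hat N$ for families of curves $\hat X(t,u)$, where $\hat N$ and $\hat k$ are the unit normal and curvature of $\hat X(t,\cdot)$. A family is a solution up to reparametrization if $\langle\hat X_t,\hat N\rangle=\hat k^{1/3}$. A curve $X:\mathbb{R}\to\mathbb{R}^2$ is an affine self-similar solution of the ACSF if there is a curve $(A(t),H(t))$, $t\in[0,T)$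 with $T>0$, in the group of affine transformations of $\mathbb{R}^2$, with $A(0)=I_2$ and $H(0)=0$, such that $\hat X(t,u)=A(t)X(u)+H(t)$ is a solution of the ACSF up to reparametrization. The curve $(A(t),H(t))$ is called the family of self-similar actions on $X$. *)

theory Defs
  imports "HOL-Analysis.Analysis"
begin

text \<open>
  C-infinity regularity on a set of parameters: \<open>D n\<close> is the \<open>n\<close>-th derivative. Derivatives are
  taken within \<open>S\<close>, so on \<open>{0..<T}\<close> they are one-sided at \<open>0\<close>.
\<close>

definition smooth_curve_on :: "real set \<Rightarrow> (real \<Rightarrow> 'a::real_normed_vector) \<Rightarrow> bool" where
  "smooth_curve_on S f \<longleftrightarrow>
     (\<exists>D :: nat \<Rightarrow> real \<Rightarrow> 'a. (\<forall>t\<in>S. D 0 t = f t) \<and>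
        (\<forall>n. \<forall>t\<in>S. (D n has_vector_derivative D (Suc n) t) (at t within S)))"

definition deriv_curve :: "(real \<Rightarrow> real^2) \<Rightarrow> real \<Rightarrow> real^2" where
  "deriv_curve X u = vector_derivative X (at u)"

definition immersed_curve :: "(real \<Rightarrow> real^2) \<Rightarrow> bool" where
  "immersed_curve X \<longleftrightarrow> smooth_curve_on UNIV X \<and> (\<forall>u. deriv_curve X u \<noteq> 0)"

definition rot_J :: "real^2^2" where
  "rot_J = vector [vector [0, - 1], vector [1, 0]]"

definition unit_tangent :: "(real \<Rightarrow> real^2) \<Rightarrow> real \<Rightarrow> real^2" where
  "unit_tangent X u = deriv_curve X u /\<^sub>R norm (deriv_curve X u)"

definition unit_normal :: "(real \<Rightarrow> real^2) \<Rightarrow> real \<Rightarrow> real^2" where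
  "unit_normal X u = rot_J *v unit_tangent X u"

text \<open>The transpose makes \<open>X\<^sub>u\<close> and \<open>X\<^sub>u\<^sub>u\<close> the columns of the matrix.\<close>

definition curvature :: "(real \<Rightarrow> real^2) \<Rightarrow> real \<Rightarrow> real" where
  "curvature X u =
     det (transpose (vector [deriv_curve X u, deriv_curve (deriv_curve X) u] :: real^2^2)) /
     norm (deriv_curve X u) ^ 3"

text \<open>
  Solutions, up to reparametrization, of the affine curve shortening flow on \<open>[0,T)\<close>. The library
  function \<open>root 3\<close> is the odd real cube root. At \<open>t = 0\<close> the time derivative is one-sided.
\<close>

definition acsf_upto_reparam :: "real \<Rightarrow> (real \<Rightarrow> real \<Rightarrow> real^2) \<Rightarrow> bool" where
  "acsf_upto_reparam T Y \<longleftrightarrow>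
     (\<forall>t\<in>{0..<T}. immersed_curve (Y t) \<and>
        (\<forall>u. \<exists>V. ((\<lambda>s. Y s u) has_vector_derivative V) (at t within {0..<T}) \<and>
                 V \<bullet> unit_normal (Y t) u = root 3 (curvature (Y t) u)))"

text \<open>
  \<open>(A, H)\<close> is a smooth curve, parametrized by \<open>[0,T)\<close>, in the affine group of the plane; only the
  values of \<open>A\<close> and \<open>H\<close> on \<open>[0,T)\<close> matter.
\<close>

definition self_similar_actions ::
    "(real \<Rightarrow> real^2) \<Rightarrow> real \<Rightarrow> (real \<Rightarrow> real^2^2) \<Rightarrow> (real \<Rightarrow> real^2) \<Rightarrow> bool" where
  "self_similar_actions X T A H \<longleftrightarrow>
     smooth_curve_on {0..<T} A \<and> smooth_curve_on {0..<T} H \<and>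
     (\<forall>t\<in>{0..<T}. invertible (A t)) \<and>
     A 0 = mat 1 \<and> H 0 = 0 \<and>
     acsf_upto_reparam T (\<lambda>t u. A t *v X u + H t)"

definition affine_self_similar :: "(real \<Rightarrow> real^2) \<Rightarrow> bool" where
  "affine_self_similar X \<longleftrightarrow> (\<exists>T>0. \<exists>A H. self_similar_actions X T A H)"

definition self_similar_eq :: "real^2^2 \<Rightarrow> real^2 \<Rightarrow> (real \<Rightarrow> real^2) \<Rightarrow> bool" where
  "self_similar_eq B C X \<longleftrightarrow>
     (\<forall>u. (B *v X u + C) \<bullet> unit_normal X u = root 3 (curvature X u))"

text \<open>
  The type \<open>real^2^2\<close> carries componentwise multiplication, so the library's \<open>exp\<close> and \<open>^\<close> are
  not the matrix operations; powers are formed here with the matrix product \<open>**\<close>.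
\<close>

definition matrix_exp :: "real^'n^'n \<Rightarrow> real^'n^'n" where
  "matrix_exp M = (\<Sum>n. (((**) M) ^^ n) (mat 1) /\<^sub>R fact n)"

definition action_A :: "real^2^2 \<Rightarrow> real \<Rightarrow> real^2^2" where
  "action_A B t =
     (if trace B = 0 then matrix_exp (t *\<^sub>R B)
      else matrix_exp ((3 / (2 * trace B) * ln (1 + 2 / 3 * trace B * t)) *\<^sub>R B))"

definition action_H :: "real^2^2 \<Rightarrow> real^2 \<Rightarrow> real \<Rightarrow> real^2" where
  "action_H B C t =
     integral {0..t} (\<lambda>s. det (action_A B s) powr (- 2 / 3) *\<^sub>R action_A B s) *v C"

end

theory Submission
  imports Defs
begin

text \<open>
  Multiplying by the speed and using that the cube root removes the cube in the curvature, the flow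
  equation for a velocity \<open>V\<close> reads \<open>\<langle>V, J X\<^sub>u\<rangle> = det(X\<^sub>u, X\<^sub>u\<^sub>u)\<^sup>1\<^sup>/\<^sup>3\<close> (lemma \<open>normal_speed_iff\<close>).  In this form
  the effect of an affine map \<open>A X + H\<close> is visible: since \<open>A\<^sup>T J A = (det A) J\<close>, a velocity \<open>A v\<close>
  multiplies the left side by \<open>det A\<close>, while the right side is multiplied by \<open>(det A)\<^sup>1\<^sup>/\<^sup>3\<close>.  Hence
  whenever \<open>v\<close> satisfies the equation for \<open>X\<close>, so does \<open>(det A)\<^sup>-\<^sup>2\<^sup>/\<^sup>3 A v\<close> for the image curve (lemma
  \<open>normal_speed_affine_image\<close>).

  If \<open>A(t) X + H(t)\<close> is a solution, the flow equation at \<open>t = 0\<close> is the self-similarity equation with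
  \<open>B = A'(0)\<close> and \<open>C = H'(0)\<close>.  Conversely, given \<open>B\<close> and \<open>C\<close>, the scaling shows that it suffices to
  have \<open>A' = (det A)\<^sup>-\<^sup>2\<^sup>/\<^sup>3 A B\<close> and \<open>H' = (det A)\<^sup>-\<^sup>2\<^sup>/\<^sup>3 A C\<close>.  Put \<open>p(t) = 1 + (2/3) tr(B) t\<close>.  The
  proposed \<open>A\<close> is \<open>exp(\<tau> B)\<close> with \<open>\<tau>' = 1 / p\<close>, so that \<open>A' = p\<^sup>-\<^sup>1 A B\<close>, and
  \<open>det A = exp(\<tau> tr B) = p\<^sup>3\<^sup>/\<^sup>2\<close>, so that \<open>(det A)\<^sup>-\<^sup>2\<^sup>/\<^sup>3 = p\<^sup>-\<^sup>1\<close>; both cases \<open>tr B = 0\<close> and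
  \<open>tr B \<noteq> 0\<close> are covered at once.  Smoothness of \<open>A\<close> and \<open>H\<close> holds because the curves \<open>p\<^sup>-\<^sup>m A Q\<close>, with
  \<open>Q\<close> a constant matrix, form a class closed under differentiation (lemma
  \<open>smooth_action_A_family\<close>).
\<close>

section \<open>The matrix exponential\<close>

abbreviation matrix_power :: "real^'n^'n \<Rightarrow> nat \<Rightarrow> real^'n^'n" where
  "matrix_power M n \<equiv> (((**) M) ^^ n) (mat 1)"

lemma matrix_power_Suc_right: "matrix_power M (Suc n) = matrix_power M n ** M"
  by (induction n) (simp_all add: matrix_mul_assoc)

lemma matrix_power_scaleR: "matrix_power (c *\<^sub>R M) n = c ^ n *\<^sub>R matrix_power M n"
proof (induction n)
  case (Suc n)
  then show ?case
    by (simp add: matrix_matrix_mult_def vec_eq_iff sum_distrib_left mult_ac)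
qed simp

text \<open>
  Any bound geometric in \<open>n\<close> makes the power series of the entries of the exponential converge for
  all times, because the factorial beats it.
\<close>

lemma abs_matrix_power_entry_le:
  fixes M :: "real^'n^'n"
  shows "\<bar>matrix_power M n $ i $ j\<bar> \<le> (\<Sum>k\<in>UNIV. \<Sum>l\<in>UNIV. \<bar>M $ k $ l\<bar>) ^ n"
proof (induction n arbitrary: i)
  case 0
  show ?case by (simp add: mat_def)
next
  case (Suc n)
  let ?K = "\<Sum>k\<in>UNIV. \<Sum>l\<in>UNIV. \<bar>M $ k $ l\<bar>"
  have "\<bar>matrix_power M (Suc n) $ i $ j\<bar> \<le> (\<Sum>l\<in>UNIV. \<bar>M $ i $ l * matrix_power M n $ l $ j\<bar>)"
    by (simp add: matrix_matrix_mult_def)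
  also have "\<dots> \<le> (\<Sum>l\<in>UNIV. \<bar>M $ i $ l\<bar> * ?K ^ n)"
    by (intro sum_mono) (simp add: abs_mult mult_left_mono Suc.IH)
  also have "\<dots> = (\<Sum>l\<in>UNIV. \<bar>M $ i $ l\<bar>) * ?K ^ n"
    by (simp add: sum_distrib_right)
  also have "\<dots> \<le> ?K * ?K ^ n"
  proof (rule mult_right_mono)
    show "(\<Sum>l\<in>UNIV. \<bar>M $ i $ l\<bar>) \<le> ?K"
      by (rule member_le_sum) (auto intro: sum_nonneg)
  qed (auto intro!: zero_le_power sum_nonneg)
  finally show ?case by simp
qed

lemma summable_matrix_power_entry:
  fixes M :: "real^'n^'n"
  shows "summable (\<lambda>n. matrix_power M n $ i $ j / fact n * t ^ n)"
proof (rule summable_comparison_test')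
  let ?K = "\<Sum>k\<in>UNIV. \<Sum>l\<in>UNIV. \<bar>M $ k $ l\<bar>"
  show "summable (\<lambda>n. inverse (fact n) * (?K * \<bar>t\<bar>) ^ n)"
    by (rule summable_exp)
  fix n :: nat
  show "norm (matrix_power M n $ i $ j / fact n * t ^ n) \<le> inverse (fact n) * (?K * \<bar>t\<bar>) ^ n"
    using mult_right_mono[OF abs_matrix_power_entry_le[where M=M and n=n and i=i and j=j], of "\<bar>t\<bar> ^ n / fact n"]
    by (simp add: abs_mult power_abs power_mult_distrib field_simps)
qed

lemma matrix_exp_entry:
  fixes M :: "real^'n^'n"
  shows "matrix_exp (t *\<^sub>R M) $ i $ j = (\<Sum>n. matrix_power M n $ i $ j / fact n * t ^ n)"
proof -
  let ?E = "\<chi> i j. \<Sum>n. matrix_power M n $ i $ j / fact n * t ^ n"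
  have "(\<lambda>n. matrix_power (t *\<^sub>R M) n /\<^sub>R fact n) sums ?E"
    unfolding sums_def
  proof (intro vec_tendstoI)
    fix i j
    have "(\<lambda>n. matrix_power M n $ i $ j / fact n * t ^ n) sums ?E $ i $ j"
      using summable_sums[OF summable_matrix_power_entry] by simp
    then show "((\<lambda>m. (\<Sum>n<m. matrix_power (t *\<^sub>R M) n /\<^sub>R fact n) $ i $ j) \<longlongrightarrow> ?E $ i $ j) sequentially"
      by (simp add: sums_def matrix_power_scaleR field_simps)
  qed
  then show ?thesis
    by (simp add: matrix_exp_def sums_iff)
qed

lemma matrix_exp_0: "matrix_exp (0 :: real^'n^'n) = mat 1"
proof -
  have "matrix_exp (0 *\<^sub>R (0 :: real^'n^'n)) $ i $ j = mat 1 $ i $ j" for i j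
    unfolding matrix_exp_entry powser_zero by simp
  then show ?thesis by (simp add: vec_eq_iff)
qed

lemma has_vector_derivative_entrywise:
  fixes F :: "real \<Rightarrow> real^'n^'m"
  assumes "\<And>i j. ((\<lambda>t. F t $ i $ j) has_real_derivative D $ i $ j) (at t within S)"
  shows "(F has_vector_derivative D) (at t within S)"
  using assms unfolding has_vector_derivative_def has_field_derivative_def
  by (subst has_derivative_componentwise_within)
     (auto simp: Basis_vec_def inner_axis mult.commute[of _ "D $ _ $ _"])

text \<open>
  Entry by entry the series is a real power series, which may be differentiated term by term.  The
  shift of coefficients this causes is right multiplication by \<open>M\<close>, as \<open>M\<^sup>n\<^sup>+\<^sup>1 = M\<^sup>n M\<close>.
\<close>

lemma has_vector_derivative_matrix_exp:
  fixes M :: "real^'n^'n"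
  shows "((\<lambda>t. matrix_exp (t *\<^sub>R M)) has_vector_derivative matrix_exp (t *\<^sub>R M) ** M) (at t)"
proof (rule has_vector_derivative_entrywise)
  fix i j
  let ?c = "\<lambda>n. matrix_power M n $ i $ j / fact n"
  have "(\<Sum>n. diffs ?c n * t ^ n) =
        (\<Sum>n. \<Sum>k\<in>UNIV. (matrix_power M n $ i $ k / fact n * t ^ n) * M $ k $ j)"
  proof (rule suminf_cong)
    fix n
    have "diffs ?c n = (matrix_power M n ** M) $ i $ j / fact n"
      unfolding diffs_def matrix_power_Suc_right by (simp add: field_simps del: of_nat_Suc)
    then show "diffs ?c n * t ^ n =
        (\<Sum>k\<in>UNIV. (matrix_power M n $ i $ k / fact n * t ^ n) * M $ k $ j)"
      by (simp add: matrix_matrix_mult_def sum_divide_distrib sum_distrib_left mult_ac)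
  qed
  also have "\<dots> = (\<Sum>k\<in>UNIV. (\<Sum>n. matrix_power M n $ i $ k / fact n * t ^ n) * M $ k $ j)"
    by (subst suminf_sum)
       (simp_all only: summable_mult2 summable_matrix_power_entry
          suminf_mult2[OF summable_matrix_power_entry])
  also have "\<dots> = (matrix_exp (t *\<^sub>R M) ** M) $ i $ j"
    by (simp add: matrix_matrix_mult_def matrix_exp_entry)
  finally have sum_eq: "(\<Sum>n. diffs ?c n * t ^ n) = (matrix_exp (t *\<^sub>R M) ** M) $ i $ j" .
  show "((\<lambda>t. matrix_exp (t *\<^sub>R M) $ i $ j) has_real_derivative
      (matrix_exp (t *\<^sub>R M) ** M) $ i $ j) (at t)"
    unfolding matrix_exp_entry sum_eq[symmetric]
    by (rule termdiffs_strong_converges_everywhere[OF summable_matrix_power_entry])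
qed

lemma has_real_derivative_entry:
  fixes F :: "real \<Rightarrow> real^'n^'m"
  assumes "(F has_vector_derivative D) (at t within S)"
  shows "((\<lambda>t. F t $ i $ j) has_real_derivative D $ i $ j) (at t within S)"
proof -
  have "bounded_linear (\<lambda>M::real^'n^'m. M $ i $ j)"
    by (simp add: bounded_linear_compose[OF bounded_linear_vec_nth bounded_linear_vec_nth])
  from bounded_linear.has_vector_derivative[OF this assms] show ?thesis
    by (simp add: has_real_derivative_iff_has_vector_derivative)
qed

text \<open>
  Liouville's formula: \<open>(det E)' = tr(M) det E\<close> when \<open>E' = E M\<close>.
\<close>

lemma det_matrix_exp_2:
  fixes M :: "real^2^2"
  shows "det (matrix_exp (t *\<^sub>R M)) = exp (t * trace M)"
proof -
  let ?E = "\<lambda>t. matrix_exp (t *\<^sub>R M)"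
  note [derivative_intros] = has_real_derivative_entry[OF has_vector_derivative_matrix_exp]
  have "((\<lambda>t. det (?E t) * exp (- t * trace M)) has_real_derivative 0) (at t)" for t
    unfolding det_2
    by (auto intro!: derivative_eq_intros)
       (simp add: matrix_matrix_mult_def trace_def sum_2 algebra_simps)
  then have "det (?E t) * exp (- t * trace M) = det (?E 0) * exp (- 0 * trace M)"
    using DERIV_isconst_all by blast
  then show ?thesis
    by (simp add: matrix_exp_0 exp_minus field_simps)
qed

section \<open>Smooth curves\<close>

text \<open>
  Dependent choice inside a class of curves closed under differentiation yields the sequence of
  higher derivatives; the class may be given by a shape rather than by explicit derivatives.
\<close>

lemma smooth_curve_on_coinduct:
  assumes "P f"
    and "\<And>f. P f \<Longrightarrow> \<exists>g. P g \<and> (\<forall>t\<in>S. (f has_vector_derivative g t) (at t within S))"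
  shows "smooth_curve_on S f"
proof -
  have "\<exists>D. \<forall>n. (P (D n) \<and> (n = 0 \<longrightarrow> D n = f)) \<and>
      (\<forall>t\<in>S. (D n has_vector_derivative D (Suc n) t) (at t within S))"
    by (rule dependent_nat_choice) (use assms in auto)
  then show ?thesis unfolding smooth_curve_on_def by metis
qed

lemma smooth_curve_on_if_derivative:
  assumes "\<And>t. t \<in> S \<Longrightarrow> (f has_vector_derivative g t) (at t within S)"
    and "smooth_curve_on S g"
  shows "smooth_curve_on S f"
proof -
  obtain D where D: "\<forall>t\<in>S. D 0 t = g t"
    "\<forall>n. \<forall>t\<in>S. (D n has_vector_derivative D (Suc n) t) (at t within S)"
    using assms(2) unfolding smooth_curve_on_def by blast
  show ?thesis
    unfolding smooth_curve_on_def
    by (rule exI[of _ "case_nat f D"]) (use D assms(1) in \<open>auto split: nat.split\<close>)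
qed

lemma smooth_curve_on_bounded_linear:
  assumes "bounded_linear L" and "smooth_curve_on S f"
  shows "smooth_curve_on S (\<lambda>t. L (f t))"
proof -
  obtain D where D: "\<forall>t\<in>S. D 0 t = f t"
    "\<forall>n. \<forall>t\<in>S. (D n has_vector_derivative D (Suc n) t) (at t within S)"
    using assms(2) unfolding smooth_curve_on_def by blast
  then show ?thesis
    unfolding smooth_curve_on_def
    by (intro exI[of _ "\<lambda>n t. L (D n t)"])
       (auto intro: bounded_linear.has_vector_derivative[OF assms(1)])
qed

lemma smooth_curve_on_add_const:
  assumes "smooth_curve_on S f"
  shows "smooth_curve_on S (\<lambda>t. f t + c)"
proof -
  obtain D where D: "\<forall>t\<in>S. D 0 t = f t"
    "\<forall>n. \<forall>t\<in>S. (D n has_vector_derivative D (Suc n) t) (at t within S)"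
    using assms unfolding smooth_curve_on_def by blast
  then show ?thesis
    unfolding smooth_curve_on_def
    by (intro exI[of _ "case_nat (\<lambda>t. D 0 t + c) (\<lambda>n. D (Suc n))"])
       (auto simp: has_vector_derivative_add_const split: nat.split)
qed

lemma smooth_curve_on_has_vector_derivative:
  assumes "smooth_curve_on S f" and "t \<in> S"
  shows "\<exists>v. (f has_vector_derivative v) (at t within S)"
proof -
  obtain D where D: "\<forall>t\<in>S. D 0 t = f t"
    "\<forall>n. \<forall>t\<in>S. (D n has_vector_derivative D (Suc n) t) (at t within S)"
    using assms(1) unfolding smooth_curve_on_def by blast
  then have "(f has_vector_derivative D 1 t) (at t within S)"
    using assms(2) by (metis One_nat_def has_vector_derivative_transform)
  then show ?thesis ..
qed

lemma smooth_curve_twice_differentiable: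
  assumes "smooth_curve_on UNIV X"
  shows "(X has_vector_derivative deriv_curve X u) (at u)"
    and "(deriv_curve X has_vector_derivative deriv_curve (deriv_curve X) u) (at u)"
proof -
  obtain D where D: "\<And>t. D 0 t = X t"
    "\<And>n t. (D n has_vector_derivative D (Suc n) t) (at t)"
    using assms unfolding smooth_curve_on_def by auto
  have "D 0 = X" using D(1) by auto
  then have X: "\<And>u. (X has_vector_derivative D 1 u) (at u)" using D(2)[of 0] by simp
  then have "deriv_curve X = D 1"
    by (intro ext) (simp add: deriv_curve_def vector_derivative_at)
  moreover have "deriv_curve (D 1) u = D 2 u"
    using D(2)[of 1] by (simp add: deriv_curve_def vector_derivative_at numeral_2_eq_2)
  ultimately show "(X has_vector_derivative deriv_curve X u) (at u)"
    "(deriv_curve X has_vector_derivative deriv_curve (deriv_curve X) u) (at u)"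
    using X D(2)[of 1 u] by (simp_all add: numeral_2_eq_2)
qed

section \<open>Affine images of a curve\<close>

text \<open>
  Both sides of the flow equation carry the same factor \<open>1 / \<parallel>X\<^sub>u\<parallel>\<close>, because the cube in the
  curvature disappears under the cube root.  Removing it leaves an equation whose two sides scale by
  powers of the determinant under affine maps, whereas \<open>\<parallel>X\<^sub>u\<parallel>\<close> changes
  by a factor that depends on \<open>u\<close>.
\<close>

lemma normal_speed_iff:
  assumes "deriv_curve X u \<noteq> 0"
  shows "w \<bullet> unit_normal X u = root 3 (curvature X u) \<longleftrightarrow>
    w \<bullet> (rot_J *v deriv_curve X u) =
      root 3 (det (transpose (vector [deriv_curve X u, deriv_curve (deriv_curve X) u] :: real^2^2)))"
  using assms
  by (simp add: unit_normal_def unit_tangent_def curvature_def real_root_divide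
      real_root_power_cancel matrix_vector_mult_scaleR field_simps)

text \<open>
  This is \<open>A\<^sup>T J A = (det A) J\<close>: the form \<open>\<langle>v, J w\<rangle>\<close> is an area form.
\<close>

lemma inner_rot_J_matrix:
  fixes A :: "real^2^2"
  shows "(A *v v) \<bullet> (rot_J *v (A *v w)) = det A * (v \<bullet> (rot_J *v w))"
  by (simp add: rot_J_def matrix_vector_mult_def inner_vec_def sum_2 det_2 algebra_simps)

lemma det_matrix_columns:
  fixes A :: "real^2^2"
  shows "det (transpose (vector [A *v v, A *v w] :: real^2^2)) =
    det A * det (transpose (vector [v, w] :: real^2^2))"
  by (simp add: matrix_vector_mult_def transpose_def sum_2 det_2 algebra_simps)

lemma deriv_curve_affine:
  fixes A :: "real^2^2"
  assumes "(X has_vector_derivative X') (at u)"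
  shows "deriv_curve (\<lambda>u. A *v X u + h) u = A *v X'"
  unfolding deriv_curve_def
  by (rule vector_derivative_at)
     (simp add: has_vector_derivative_add_const
       bounded_linear.has_vector_derivative[OF matrix_vector_mul_bounded_linear assms])

lemma deriv_curve_affine_image:
  fixes A :: "real^2^2"
  assumes "immersed_curve X"
  shows "deriv_curve (\<lambda>u. A *v X u + h) = (\<lambda>u. A *v deriv_curve X u)"
    and "deriv_curve (deriv_curve (\<lambda>u. A *v X u + h)) u = A *v deriv_curve (deriv_curve X) u"
proof -
  have X: "smooth_curve_on UNIV X" using assms by (simp add: immersed_curve_def)
  show 1: "deriv_curve (\<lambda>u. A *v X u + h) = (\<lambda>u. A *v deriv_curve X u)"
    using deriv_curve_affine[OF smooth_curve_twice_differentiable(1)[OF X]] by auto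
  show "deriv_curve (deriv_curve (\<lambda>u. A *v X u + h)) u = A *v deriv_curve (deriv_curve X) u"
    using deriv_curve_affine[OF smooth_curve_twice_differentiable(2)[OF X], of A 0 u]
    by (simp add: 1)
qed

lemma immersed_curve_affine_image:
  fixes A :: "real^2^2"
  assumes "immersed_curve X" and "invertible A"
  shows "immersed_curve (\<lambda>u. A *v X u + h)"
  unfolding immersed_curve_def
proof (intro conjI allI)
  show "smooth_curve_on UNIV (\<lambda>u. A *v X u + h)"
    using assms(1) unfolding immersed_curve_def
    by (intro smooth_curve_on_add_const
        smooth_curve_on_bounded_linear[OF matrix_vector_mul_bounded_linear]) auto
  fix u
  have "A *v deriv_curve X u \<noteq> 0"
    using assms by (metis immersed_curve_def invertible_def matrix_vector_mul_assoc
      matrix_vector_mul_lid matrix_vector_mult_0_right)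
  then show "deriv_curve (\<lambda>u. A *v X u + h) u \<noteq> 0"
    by (simp add: deriv_curve_affine_image[OF assms(1)])
qed

text \<open>
  The exponent balances the two scalings: \<open>det A\<close> for the normal velocity and \<open>(det A)\<^sup>1\<^sup>/\<^sup>3\<close> for the
  cube root of \<open>det(X\<^sub>u, X\<^sub>u\<^sub>u)\<close>.
\<close>

lemma normal_speed_affine_image:
  fixes A :: "real^2^2"
  assumes X: "immersed_curve X" and "0 < det A"
    and eq: "v \<bullet> unit_normal X u = root 3 (curvature X u)"
  shows "(det A powr (- 2 / 3) *\<^sub>R (A *v v)) \<bullet> unit_normal (\<lambda>u. A *v X u + h) u =
    root 3 (curvature (\<lambda>u. A *v X u + h) u)"
proof -
  let ?Y = "\<lambda>u. A *v X u + h"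
  have Y: "immersed_curve ?Y"
    using immersed_curve_affine_image[OF X] \<open>0 < det A\<close> by (simp add: invertible_det_nz)
  have "det A powr (- 2 / 3) * det A = det A powr (- 2 / 3) * det A powr 1"
    using \<open>0 < det A\<close> by simp
  also have "\<dots> = root 3 (det A)"
    unfolding powr_add[symmetric] using \<open>0 < det A\<close> by (simp add: root_powr_inverse)
  finally have *: "det A powr (- 2 / 3) * det A = root 3 (det A)" .
  have 1: "v \<bullet> (rot_J *v deriv_curve X u) =
      root 3 (det (transpose (vector [deriv_curve X u, deriv_curve (deriv_curve X) u] :: real^2^2)))"
    using X eq normal_speed_iff by (auto simp: immersed_curve_def)
  have "(det A powr (- 2 / 3) *\<^sub>R (A *v v)) \<bullet> (rot_J *v deriv_curve ?Y u) =
      (det A powr (- 2 / 3) * det A) * (v \<bullet> (rot_J *v deriv_curve X u))"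
    by (simp add: deriv_curve_affine_image(1)[OF X] inner_rot_J_matrix)
  also have "\<dots> = root 3
      (det (transpose (vector [deriv_curve ?Y u, deriv_curve (deriv_curve ?Y) u] :: real^2^2)))"
    by (simp only: * 1 deriv_curve_affine_image(2)[OF X])
       (simp only: deriv_curve_affine_image(1)[OF X] det_matrix_columns real_root_mult)
  finally have flow: "(det A powr (- 2 / 3) *\<^sub>R (A *v v)) \<bullet> (rot_J *v deriv_curve ?Y u) = \<dots>" .
  have "deriv_curve ?Y u \<noteq> 0"
    using Y by (simp add: immersed_curve_def)
  from normal_speed_iff[THEN iffD2, OF this flow] show ?thesis .
qed

section \<open>The self-similar actions\<close>

lemma bounded_linear_matrix_vector_mult_left:
  "bounded_linear (\<lambda>M :: real^'n^'m. M *v x)"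
  by (simp add: linear_conv_bounded_linear[symmetric] linear_iff matrix_vector_mult_add_rdistrib
      scaleR_matrix_vector_assoc)

lemma bounded_linear_matrix_mult_left:
  "bounded_linear (\<lambda>M :: real^'n^'m. M ** (Q :: real^'k^'n))"
  by (simp add: linear_conv_bounded_linear[symmetric] linear_iff vec_eq_iff
      matrix_matrix_mult_def sum.distrib sum_distrib_left algebra_simps)

text \<open>
  The flow equation at time \<open>0\<close>, where the action is the identity, is already the equation sought.
\<close>

lemma self_similar_eq_if_self_similar_actions:
  assumes X: "immersed_curve X" and "0 < T" and AH: "self_similar_actions X T A H"
  shows "\<exists>B C. self_similar_eq B C X"
proof -
  let ?S = "{0..<T}"
  have 0: "0 \<in> ?S" "A 0 = mat 1" "H 0 = 0" using AH \<open>0 < T\<close> by (auto simp: self_similar_actions_def)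
  obtain B C where B: "(A has_vector_derivative B) (at 0 within ?S)"
    and C: "(H has_vector_derivative C) (at 0 within ?S)"
    using AH smooth_curve_on_has_vector_derivative[OF _ 0(1)]
    unfolding self_similar_actions_def by metis
  have "(B *v X u + C) \<bullet> unit_normal X u = root 3 (curvature X u)" for u
  proof -
    have flow: "acsf_upto_reparam T (\<lambda>t u. A t *v X u + H t)"
      using AH by (simp add: self_similar_actions_def)
    obtain V where V: "((\<lambda>t. A t *v X u + H t) has_vector_derivative V) (at 0 within ?S)"
      and eq: "V \<bullet> unit_normal (\<lambda>u. A 0 *v X u + H 0) u = root 3 (curvature (\<lambda>u. A 0 *v X u + H 0) u)"
      using flow 0(1) unfolding acsf_upto_reparam_def by meson
    have "((\<lambda>t. A t *v X u + H t) has_vector_derivative B *v X u + C) (at 0 within ?S)"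
      by (intro has_vector_derivative_add C
          bounded_linear.has_vector_derivative[OF bounded_linear_matrix_vector_mult_left B])
    moreover have "at 0 within ?S \<noteq> bot"
      using \<open>0 < T\<close>
      by (auto simp: trivial_limit_within intro!: islimpt_closure_open[of "{0<..<T}"])
    ultimately have "V = B *v X u + C"
      using V vector_derivative_unique_within by blast
    with eq show ?thesis by (simp add: 0)
  qed
  then show ?thesis unfolding self_similar_eq_def by blast
qed

context
  fixes B :: "real^2^2" and p :: "real \<Rightarrow> real"
  defines "p \<equiv> \<lambda>t. 1 + 2 / 3 * trace B * t"
begin

lemma has_real_derivative_p: "(p has_real_derivative 2 / 3 * trace B) (at t)"
  unfolding p_def by (auto intro!: derivative_eq_intros)

text \<open>
  The exponent \<open>3/2\<close> comes from the constant \<open>3 / (2 tr B)\<close> in the definition: the trace cancels in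
  \<open>\<tau> tr B = (3/2) ln p\<close>.  For \<open>tr B = 0\<close> both sides are \<open>1\<close>.
\<close>

lemma det_action_A:
  assumes "0 < p t"
  shows "det (action_A B t) = p t powr (3 / 2)"
  using assms
  by (simp add: action_A_def det_matrix_exp_2 p_def powr_def)

lemma det_action_A_powr:
  assumes "0 < p t"
  shows "det (action_A B t) powr (- 2 / 3) = inverse (p t)"
  using assms by (simp add: det_action_A powr_powr powr_minus)

text \<open>
  In both cases of the definition, \<open>action_A B\<close> is the exponential at a time \<open>\<tau>\<close> with \<open>\<tau>' = 1 / p\<close>.
\<close>

lemma has_vector_derivative_action_A:
  assumes "0 < p t"
  shows "(action_A B has_vector_derivative inverse (p t) *\<^sub>R (action_A B t ** B)) (at t)"
proof -
  define \<tau> where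
    "\<tau> = (\<lambda>t. if trace B = 0 then t else 3 / (2 * trace B) * ln (1 + 2 / 3 * trace B * t))"
  have A: "action_A B = (\<lambda>t. matrix_exp (t *\<^sub>R B)) \<circ> \<tau>"
    by (auto simp: action_A_def \<tau>_def)
  have "(\<tau> has_real_derivative inverse (p t)) (at t)"
  proof (cases "trace B = 0")
    case True
    then show ?thesis by (simp add: \<tau>_def p_def)
  next
    case False
    then have "\<tau> = (\<lambda>t. 3 / (2 * trace B) * ln (p t))" by (simp add: \<tau>_def p_def)
    then show ?thesis
      using DERIV_cmult[OF DERIV_chain2[OF DERIV_ln[OF assms] has_real_derivative_p],
          of "3 / (2 * trace B)"] False
      by simp
  qed
  then have "(\<tau> has_vector_derivative inverse (p t)) (at t)"
    by (simp add: has_real_derivative_iff_has_vector_derivative)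
  from vector_diff_chain_at[OF this has_vector_derivative_matrix_exp] show ?thesis
    by (simp add: A)
qed

text \<open>
  Differentiating \<open>p\<^sup>-\<^sup>m A Q\<close> gives a curve of the same form with exponent \<open>m + 1\<close>, since \<open>A' = p\<^sup>-\<^sup>1 A B\<close>
  and \<open>p'\<close> is constant.  The case \<open>m = 0\<close> is \<open>A\<close> and the case \<open>m = 1\<close> is \<open>H'\<close>, up to constants.
\<close>

lemma smooth_action_A_family:
  assumes "\<And>t. t \<in> S \<Longrightarrow> 0 < p t"
  shows "smooth_curve_on S (\<lambda>t. inverse (p t) ^ m *\<^sub>R (action_A B t ** Q))"
proof (rule smooth_curve_on_coinduct[where P =
      "\<lambda>f. \<exists>m Q. f = (\<lambda>t. inverse (p t) ^ m *\<^sub>R (action_A B t ** Q))"])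
  fix f assume "\<exists>m Q. f = (\<lambda>t. inverse (p t) ^ m *\<^sub>R (action_A B t ** Q))"
  then obtain m Q where f: "f = (\<lambda>t. inverse (p t) ^ m *\<^sub>R (action_A B t ** Q))" by blast
  let ?Q = "B ** Q - (real m * (2 / 3 * trace B)) *\<^sub>R Q"
  let ?g = "\<lambda>t. inverse (p t) ^ Suc m *\<^sub>R (action_A B t ** ?Q)"
  have "(f has_vector_derivative ?g t) (at t within S)" if "t \<in> S" for t
  proof -
    have pos: "0 < p t" using assms that .
    have p: "((\<lambda>t. inverse (p t) ^ m) has_real_derivative
        - (real m * (2 / 3 * trace B)) * inverse (p t) ^ Suc m) (at t)"
      using DERIV_power[OF DERIV_inverse_fun[OF has_real_derivative_p], of t m] pos
      by (cases m) (simp_all add: algebra_simps)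
    have A: "((\<lambda>t. action_A B t ** Q) has_vector_derivative
        (inverse (p t) *\<^sub>R (action_A B t ** B)) ** Q) (at t)"
      by (rule bounded_linear.has_vector_derivative[OF bounded_linear_matrix_mult_left
          has_vector_derivative_action_A[OF pos]])
    have "(f has_vector_derivative ?g t) (at t)"
      unfolding f
      by (rule has_vector_derivative_eq_rhs[OF has_vector_derivative_scaleR[OF p A]])
         (simp add: vec_eq_iff matrix_matrix_mult_def sum_2 algebra_simps)
    then show ?thesis by (rule has_vector_derivative_at_within)
  qed
  then show "\<exists>g. (\<exists>m Q. g = (\<lambda>t. inverse (p t) ^ m *\<^sub>R (action_A B t ** Q))) \<and>
      (\<forall>t\<in>S. (f has_vector_derivative g t) (at t within S))"
    by (intro exI[of _ ?g]) blast
qed blast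

lemma has_vector_derivative_action_H:
  assumes pos: "\<forall>t\<in>{0..<T}. 0 < p t" and t: "t \<in> {0..<T}"
  shows "(action_H B C has_vector_derivative inverse (p t) *\<^sub>R (action_A B t *v C))
    (at t within {0..<T})"
proof -
  \<comment> \<open>The half-open time interval is exchanged for a compact one that looks the same near \<open>t\<close>.\<close>
  obtain b where b: "t < b" "b < T" using t dense[of t T] by auto
  let ?f = "\<lambda>s. det (action_A B s) powr (- 2 / 3) *\<^sub>R action_A B s"
  let ?g = "\<lambda>s. inverse (p s) *\<^sub>R action_A B s"
  have fg: "?f s = ?g s" if "s \<in> {0..b}" for s
    using det_action_A_powr[of s] pos b that by simp
  have "continuous_on {0..b} ?g"
  proof (intro continuous_on_scaleR)
    show "continuous_on {0..b} (\<lambda>s. inverse (p s))"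
      using pos b t unfolding p_def by (intro continuous_intros) force
    show "continuous_on {0..b} (action_A B)"
      using pos b t
      by (intro continuous_at_imp_continuous_on ballI
          has_vector_derivative_continuous[OF has_vector_derivative_action_A]) auto
  qed
  then have "continuous_on {0..b} ?f"
    by (subst continuous_on_cong[OF refl fg])
  then have "((\<lambda>u. integral {0..u} ?f) has_vector_derivative ?f t) (at t within {0..b})"
    by (rule integral_has_vector_derivative) (use b t in auto)
  then have "((\<lambda>u. integral {0..u} ?f) has_vector_derivative ?g t) (at t within {0..b})"
    by (rule has_vector_derivative_eq_rhs) (use fg b t in simp)
  moreover have "at t within {0..b} = at t within {0..<T}"
    by (rule at_within_nhd[of _ "{..<b}"]) (use b in auto)
  ultimately have "((\<lambda>u. integral {0..u} ?f) has_vector_derivative ?g t) (at t within {0..<T})"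
    by simp
  from bounded_linear.has_vector_derivative[OF bounded_linear_matrix_vector_mult_left this]
  show ?thesis
    by (simp add: action_H_def[abs_def] scaleR_matrix_vector_assoc)
qed

lemma self_similar_actions_action:
  assumes X: "immersed_curve X" and eq: "self_similar_eq B C X"
    and pos: "\<forall>t\<in>{0..<T}. 0 < p t"
  shows "self_similar_actions X T (action_A B) (action_H B C)"
  unfolding self_similar_actions_def
proof (intro conjI ballI)
  let ?S = "{0..<T}"
  show "smooth_curve_on ?S (action_A B)"
    using smooth_action_A_family[of ?S 0 "mat 1"] pos by simp
  show "smooth_curve_on ?S (action_H B C)"
  proof (rule smooth_curve_on_if_derivative)
    show "(action_H B C has_vector_derivative inverse (p t) *\<^sub>R (action_A B t *v C))
        (at t within ?S)" if "t \<in> ?S" for t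
      using has_vector_derivative_action_H[OF pos that] .
    have "smooth_curve_on ?S (\<lambda>t. (inverse (p t) ^ 1 *\<^sub>R (action_A B t ** mat 1)) *v C)"
      using pos
      by (intro smooth_curve_on_bounded_linear[OF bounded_linear_matrix_vector_mult_left]
          smooth_action_A_family) auto
    then show "smooth_curve_on ?S (\<lambda>t. inverse (p t) *\<^sub>R (action_A B t *v C))"
      by (simp add: scaleR_matrix_vector_assoc)
  qed
  have det: "0 < det (action_A B t)" if "t \<in> ?S" for t
  proof -
    have "0 < p t" using pos that by blast
    then show ?thesis by (simp add: det_action_A)
  qed
  then show inv: "invertible (action_A B t)" if "t \<in> ?S" for t
    using that by (force simp: invertible_det_nz)
  show "action_A B 0 = mat 1"
    by (simp add: action_A_def matrix_exp_0)
  show "action_H B C 0 = 0"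
    by (simp add: action_H_def)
  show "acsf_upto_reparam T (\<lambda>t u. action_A B t *v X u + action_H B C t)"
    unfolding acsf_upto_reparam_def
  proof (intro ballI conjI allI)
    fix t u assume t: "t \<in> ?S"
    show "immersed_curve (\<lambda>u. action_A B t *v X u + action_H B C t)"
      using immersed_curve_affine_image[OF X inv[OF t]] .
    let ?V = "det (action_A B t) powr (- 2 / 3) *\<^sub>R (action_A B t *v (B *v X u + C))"
    have pt: "0 < p t" using pos t by blast
    have "((\<lambda>s. action_A B s *v X u + action_H B C s) has_vector_derivative
        (inverse (p t) *\<^sub>R (action_A B t ** B)) *v X u + inverse (p t) *\<^sub>R (action_A B t *v C))
        (at t within ?S)"
      by (intro has_vector_derivative_add has_vector_derivative_action_H[OF pos t]
          bounded_linear.has_vector_derivative[OF bounded_linear_matrix_vector_mult_left]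
          has_vector_derivative_at_within[OF has_vector_derivative_action_A[OF pt]])
    then have "((\<lambda>s. action_A B s *v X u + action_H B C s) has_vector_derivative ?V)
        (at t within ?S)"
      by (simp only: det_action_A_powr[OF pt])
         (simp add: matrix_vector_right_distrib matrix_vector_mul_assoc scaleR_add_right
            scaleR_matrix_vector_assoc[symmetric])
    moreover have "?V \<bullet> unit_normal (\<lambda>u. action_A B t *v X u + action_H B C t) u =
        root 3 (curvature (\<lambda>u. action_A B t *v X u + action_H B C t) u)"
      using eq by (intro normal_speed_affine_image[OF X det[OF t]]) (simp add: self_similar_eq_def)
    ultimately show "\<exists>V. ((\<lambda>s. action_A B s *v X u + action_H B C s) has_vector_derivative V)
          (at t within ?S) \<and>
        V \<bullet> unit_normal (\<lambda>u. action_A B t *v X u + action_H B C t) u =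
        root 3 (curvature (\<lambda>u. action_A B t *v X u + action_H B C t) u)"
      by blast
  qed
qed

end

theorem lemma2p1:
  fixes X :: "real \<Rightarrow> real^2"
  assumes "immersed_curve X"
  shows "(affine_self_similar X \<longleftrightarrow> (\<exists>B C. self_similar_eq B C X)) \<and>
         (\<forall>B C T. self_similar_eq B C X \<longrightarrow> 0 < T \<longrightarrow>
            (\<forall>t\<in>{0..<T}. 0 < 1 + 2 / 3 * trace B * t) \<longrightarrow>
            self_similar_actions X T (action_A B) (action_H B C))"
proof (intro conjI allI impI iffI)
  show "\<exists>B C. self_similar_eq B C X" if "affine_self_similar X"
    using that self_similar_eq_if_self_similar_actions[OF assms]
    unfolding affine_self_similar_def by blast
  show actions: "self_similar_actions X T (action_A B) (action_H B C)"
    if "self_similar_eq B C X" "\<forall>t\<in>{0..<T}. 0 < 1 + 2 / 3 * trace B * t" for B C T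
    using self_similar_actions_action[OF assms that] .
  show "affine_self_similar X" if "\<exists>B C. self_similar_eq B C X"
  proof -
    obtain B C where eq: "self_similar_eq B C X" using \<open>\<exists>B C. self_similar_eq B C X\<close> by blast
    \<comment> \<open>For negative trace \<open>p\<close> vanishes at \<open>3 / (2 \<bar>tr B\<bar>)\<close>; this time is shorter and also covers trace \<open>0\<close>.\<close>
    define T where "T = 1 / (1 + \<bar>trace B\<bar>)"
    have T: "0 < T" "\<bar>trace B\<bar> * T < 1" by (auto simp: T_def field_simps)
    have "0 < 1 + 2 / 3 * trace B * t" if "t \<in> {0..<T}" for t
    proof -
      have "- (trace B * t) \<le> \<bar>trace B\<bar> * t"
        using that by (metis abs_ge_minus_self abs_mult abs_of_nonneg atLeastLessThan_iff)
      also have "\<dots> \<le> \<bar>trace B\<bar> * T" using that by (intro mult_left_mono) auto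
      finally show ?thesis using T by linarith
    qed
    with actions[OF eq] T show ?thesis unfolding affine_self_similar_def by blast
  qed
qed

end
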